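(* Let $\mathfrak{A}=(A;\vee,\wedge,\odot,\rightarrow,0,1)$ be a residuated lattice. The following assertions are equivalent: (1) $\mathfrak{A}$ is mp; (2) $\mathfrak{A}/D(\mathfrak{p})$ is a domain, for any prime filter $\mathfrak{p}$ of $\mathfrak{A}$; (3) $\mathfrak{A}/D(\mathfrak{m})$ is a domain, for any maximal filter $\mathfrak{m}$ of $\mathfrak{A}$.
   Context: A residuated lattice is an algebra $\mathfrak{A}=(A;\vee,\wedge,\odot,\rightarrow,0,1)$ such that $(A;\vee,\wedge,0,1)$ is a bounded lattice, $(A;\odot,1)$ is a commutative monoid, and $x\odot y\leq z$ iff $x\leq y\rightarrow z$ for all $x,y,z\in A$. It is non-degenerate if $0\neq 1$. A filter of $\mathfrak{A}$ is a non-empty subset $F\subseteq A$ with $x\odot y\in F$ for all $x,y\in F$, and $x\vee y\in F$ for all $x\in F$, $y\in A$; it is proper if $F\ne A$. A maximal filter is a maximal proper filter. A prime filter is a proper filter $\mathfrak{p}$ that is meet-irreducible among filters (equivalently, $x\vee y\in\mathfrak{p}$ implies $x\in\mathfrak{p}$ or $y\in\mathfrak{p}$); a minimal prime filter is an inclusion-minimal prime filter. $\mathfrak{A}$ is mp if every prime filter contains a unique minimal prime filter. For a proper filter $H$, $D(H)=\{a\in A\mid a\vee x=1\text{ for some }x\in A\setminus H\}$; for a prime filter $H$ this is a filter. For a filter $F$, $\mathfrak{A}/F$ is the quotient residuated lattice by the congruence $x\sim y$ iff $x\rightarrow y\in F$ and $y\rightarrow x\in F$. The elements of $D(\{1\})$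 are the unit divisors of $\mathfrak{A}$. A non-degenerate residuated lattice is a domain if it has no unit divisor other than $1$, i.e. $x\vee y=1$ implies $x=1$ or $y=1$. *)

theory Defs
  imports "HOL-Algebra.Group"
begin

text \<open>
  The signature extends the record of monoids: \<open>mult\<close> and \<open>one\<close> are the operation
  written as a circled dot and the constant 1. All operations matter only on the carrier.
\<close>

record 'a residuated_lattice = "'a monoid" +
  rjoin :: "'a \<Rightarrow> 'a \<Rightarrow> 'a" (infixl "\<curlyvee>\<index>" 65)
  rmeet :: "'a \<Rightarrow> 'a \<Rightarrow> 'a" (infixl "\<curlywedge>\<index>" 70)
  rimp  :: "'a \<Rightarrow> 'a \<Rightarrow> 'a" (infixr "\<rightharpoonup>\<index>" 60)
  rbot  :: "'a" ("\<bottom>\<^sub>r\<index>")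

definition rle :: "('a, 'b) residuated_lattice_scheme \<Rightarrow> 'a \<Rightarrow> 'a \<Rightarrow> bool" (infix "\<preceq>\<index>" 50)
  where "x \<preceq>\<^bsub>A\<^esub> y \<longleftrightarrow> x \<curlyvee>\<^bsub>A\<^esub> y = y"

locale residuated_lattice = comm_monoid A
  for A :: "('a, 'b) residuated_lattice_scheme" (structure) +
  assumes join_closed: "\<lbrakk>x \<in> carrier A; y \<in> carrier A\<rbrakk> \<Longrightarrow> x \<curlyvee> y \<in> carrier A"
    and meet_closed: "\<lbrakk>x \<in> carrier A; y \<in> carrier A\<rbrakk> \<Longrightarrow> x \<curlywedge> y \<in> carrier A"
    and imp_closed: "\<lbrakk>x \<in> carrier A; y \<in> carrier A\<rbrakk> \<Longrightarrow> x \<rightharpoonup> y \<in> carrier A"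
    and bot_closed: "\<bottom>\<^sub>r \<in> carrier A"
    and join_commute: "\<lbrakk>x \<in> carrier A; y \<in> carrier A\<rbrakk> \<Longrightarrow> x \<curlyvee> y = y \<curlyvee> x"
    and meet_commute: "\<lbrakk>x \<in> carrier A; y \<in> carrier A\<rbrakk> \<Longrightarrow> x \<curlywedge> y = y \<curlywedge> x"
    and join_assoc: "\<lbrakk>x \<in> carrier A; y \<in> carrier A; z \<in> carrier A\<rbrakk>
           \<Longrightarrow> (x \<curlyvee> y) \<curlyvee> z = x \<curlyvee> (y \<curlyvee> z)"
    and meet_assoc: "\<lbrakk>x \<in> carrier A; y \<in> carrier A; z \<in> carrier A\<rbrakk>
           \<Longrightarrow> (x \<curlywedge> y) \<curlywedge> z = x \<curlywedge> (y \<curlywedge> z)"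
    and join_meet_absorb: "\<lbrakk>x \<in> carrier A; y \<in> carrier A\<rbrakk> \<Longrightarrow> x \<curlyvee> (x \<curlywedge> y) = x"
    and meet_join_absorb: "\<lbrakk>x \<in> carrier A; y \<in> carrier A\<rbrakk> \<Longrightarrow> x \<curlywedge> (x \<curlyvee> y) = x"
    and bot_least: "x \<in> carrier A \<Longrightarrow> \<bottom>\<^sub>r \<preceq> x"
    and one_greatest: "x \<in> carrier A \<Longrightarrow> x \<preceq> \<one>"
    and residuation: "\<lbrakk>x \<in> carrier A; y \<in> carrier A; z \<in> carrier A\<rbrakk>
           \<Longrightarrow> x \<otimes> y \<preceq> z \<longleftrightarrow> x \<preceq> y \<rightharpoonup> z"

definition rl_filter :: "('a, 'b) residuated_lattice_scheme \<Rightarrow> 'a set \<Rightarrow> bool"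
  where "rl_filter A F \<longleftrightarrow>
    F \<noteq> {} \<and> F \<subseteq> carrier A \<and>
    (\<forall>x\<in>F. \<forall>y\<in>F. x \<otimes>\<^bsub>A\<^esub> y \<in> F) \<and>
    (\<forall>x\<in>F. \<forall>y\<in>carrier A. x \<curlyvee>\<^bsub>A\<^esub> y \<in> F)"

definition proper_filter :: "('a, 'b) residuated_lattice_scheme \<Rightarrow> 'a set \<Rightarrow> bool"
  where "proper_filter A F \<longleftrightarrow> rl_filter A F \<and> F \<noteq> carrier A"

definition maximal_filter :: "('a, 'b) residuated_lattice_scheme \<Rightarrow> 'a set \<Rightarrow> bool"
  where "maximal_filter A M \<longleftrightarrow>
    proper_filter A M \<and> (\<forall>F. proper_filter A F \<and> M \<subseteq> F \<longrightarrow> F = M)"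

definition prime_filter :: "('a, 'b) residuated_lattice_scheme \<Rightarrow> 'a set \<Rightarrow> bool"
  where "prime_filter A P \<longleftrightarrow>
    proper_filter A P \<and>
    (\<forall>F G. rl_filter A F \<and> rl_filter A G \<and> F \<inter> G = P \<longrightarrow> F = P \<or> G = P)"

definition minimal_prime_filter :: "('a, 'b) residuated_lattice_scheme \<Rightarrow> 'a set \<Rightarrow> bool"
  where "minimal_prime_filter A P \<longleftrightarrow>
    prime_filter A P \<and> (\<forall>Q. prime_filter A Q \<and> Q \<subseteq> P \<longrightarrow> Q = P)"

definition mp_residuated_lattice :: "('a, 'b) residuated_lattice_scheme \<Rightarrow> bool"
  where "mp_residuated_lattice A \<longleftrightarrow>
    residuated_lattice A \<and>
    (\<forall>P. prime_filter A P \<longrightarrow> (\<exists>!Q. minimal_prime_filter A Q \<and> Q \<subseteq> P))"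

definition D_set :: "('a, 'b) residuated_lattice_scheme \<Rightarrow> 'a set \<Rightarrow> 'a set"
  where "D_set A H = {a \<in> carrier A. \<exists>x \<in> carrier A - H. a \<curlyvee>\<^bsub>A\<^esub> x = \<one>\<^bsub>A\<^esub>}"

definition unit_divisors :: "('a, 'b) residuated_lattice_scheme \<Rightarrow> 'a set"
  where "unit_divisors A = D_set A {\<one>\<^bsub>A\<^esub>}"

definition rl_domain :: "('a, 'b) residuated_lattice_scheme \<Rightarrow> bool"
  where "rl_domain A \<longleftrightarrow>
    residuated_lattice A \<and> \<bottom>\<^sub>r\<^bsub>A\<^esub> \<noteq> \<one>\<^bsub>A\<^esub> \<and> (\<forall>a \<in> unit_divisors A. a = \<one>\<^bsub>A\<^esub>)"

definition filter_cong :: "('a, 'b) residuated_lattice_scheme \<Rightarrow> 'a set \<Rightarrow> ('a \<times> 'a) set"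
  where "filter_cong A F =
    {(x, y). x \<in> carrier A \<and> y \<in> carrier A \<and> x \<rightharpoonup>\<^bsub>A\<^esub> y \<in> F \<and> y \<rightharpoonup>\<^bsub>A\<^esub> x \<in> F}"

text \<open>
  For a filter \<open>F\<close> the classes united below all coincide, since \<open>filter_cong A F\<close> is a
  congruence; so each operation on classes is the one induced by representatives.
\<close>

definition rl_quotient ::
    "('a, 'b) residuated_lattice_scheme \<Rightarrow> 'a set \<Rightarrow> 'a set residuated_lattice"
    (infixl "'/'/\<^sub>r" 65)
  where "A //\<^sub>r F =
    \<lparr>carrier = carrier A // filter_cong A F,
     mult = \<lambda>X Y. \<Union>x\<in>X. \<Union>y\<in>Y. filter_cong A F `` {x \<otimes>\<^bsub>A\<^esub> y},
     one = filter_cong A F `` {\<one>\<^bsub>A\<^esub>},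
     rjoin = \<lambda>X Y. \<Union>x\<in>X. \<Union>y\<in>Y. filter_cong A F `` {x \<curlyvee>\<^bsub>A\<^esub> y},
     rmeet = \<lambda>X Y. \<Union>x\<in>X. \<Union>y\<in>Y. filter_cong A F `` {x \<curlywedge>\<^bsub>A\<^esub> y},
     rimp = \<lambda>X Y. \<Union>x\<in>X. \<Union>y\<in>Y. filter_cong A F `` {x \<rightharpoonup>\<^bsub>A\<^esub> y},
     rbot = filter_cong A F `` {\<bottom>\<^sub>r\<^bsub>A\<^esub>}\<rparr>"

end

theory Submission
  imports Defs
begin

text \<open>
  The quotient by a filter \<open>F\<close> is a domain exactly when \<open>F\<close> is prime
  (\<open>quotient_domain_iff_prime\<close>), because the classes of \<open>x\<close> and \<open>y\<close> join to \<open>1\<close> exactly when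
  \<open>x \<curlyvee> y \<in> F\<close>, and primeness can be tested on joins (\<open>prime_filter_iff_join\<close>). The
  statement thus asks when the filters \<open>D_set A P\<close> are prime.

  For a prime filter \<open>P\<close>, the filter \<open>D_set A P\<close> is the intersection of the prime filters
  contained in \<open>P\<close>. One inclusion (\<open>D_set_subset_prime\<close>) is immediate: \<open>a \<curlyvee> x = 1\<close> with \<open>x\<close>
  outside \<open>P\<close> forces \<open>a\<close> into every prime filter inside \<open>P\<close>. The other
  (\<open>prime_filter_omitting\<close>) is a prime filter theorem, obtained from Zorn's lemma.

  If the residuated lattice is mp, all prime filters inside \<open>P\<close> contain the same minimal prime
  filter \<open>Q\<close>, so their intersection is \<open>Q\<close>, and \<open>D_set A P = Q\<close> is prime
  (\<open>mp_D_set_prime\<close>). Conversely, let \<open>D_set A M\<close> be prime for a maximal filter \<open>M\<close>. It is then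
  the least prime filter inside \<open>M\<close>, so every prime filter inside \<open>M\<close> contains exactly one
  minimal prime filter, namely \<open>D_set A M\<close> (\<open>mp_if_maximal_D_set_prime\<close>); and every prime filter
  lies inside some maximal filter. As maximal filters are prime, the condition on all prime
  filters implies the one on maximal filters, which closes the circle.
\<close>

section \<open>Order and arithmetic\<close>

lemma (in residuated_lattice) join_idem: "x \<in> carrier A \<Longrightarrow> x \<curlyvee> x = x"
  by (metis join_meet_absorb meet_join_absorb join_closed)

lemma (in residuated_lattice) le_refl: "x \<in> carrier A \<Longrightarrow> x \<preceq> x"
  by (simp add: rle_def join_idem)

lemma (in residuated_lattice) le_antisym:
  "\<lbrakk>x \<preceq> y; y \<preceq> x; x \<in> carrier A; y \<in> carrier A\<rbrakk> \<Longrightarrow> x = y"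
  by (metis rle_def join_commute)

lemma (in residuated_lattice) le_trans:
  "\<lbrakk>x \<preceq> y; y \<preceq> z; x \<in> carrier A; y \<in> carrier A; z \<in> carrier A\<rbrakk> \<Longrightarrow> x \<preceq> z"
  by (metis rle_def join_assoc)

lemma (in residuated_lattice) le_join1: "\<lbrakk>x \<in> carrier A; y \<in> carrier A\<rbrakk> \<Longrightarrow> x \<preceq> x \<curlyvee> y"
  by (metis rle_def join_assoc join_idem)

lemma (in residuated_lattice) le_join2: "\<lbrakk>x \<in> carrier A; y \<in> carrier A\<rbrakk> \<Longrightarrow> y \<preceq> x \<curlyvee> y"
  by (metis le_join1 join_commute)

lemma (in residuated_lattice) join_least:
  "\<lbrakk>x \<preceq> z; y \<preceq> z; x \<in> carrier A; y \<in> carrier A; z \<in> carrier A\<rbrakk> \<Longrightarrow> x \<curlyvee> y \<preceq> z"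
  by (metis rle_def join_assoc)

lemma (in residuated_lattice) join_mono1:
  assumes "x \<preceq> y" "x \<in> carrier A" "y \<in> carrier A" "z \<in> carrier A"
  shows "x \<curlyvee> z \<preceq> y \<curlyvee> z"
  using assms le_trans[OF assms(1) le_join1[of y z]] by (simp add: join_least join_closed le_join2)

lemma (in residuated_lattice) le_iff_meet:
  "\<lbrakk>x \<in> carrier A; y \<in> carrier A\<rbrakk> \<Longrightarrow> x \<preceq> y \<longleftrightarrow> x \<curlywedge> y = x"
  by (metis rle_def meet_join_absorb join_meet_absorb meet_commute join_commute)

lemma (in residuated_lattice) meet_le1: "\<lbrakk>x \<in> carrier A; y \<in> carrier A\<rbrakk> \<Longrightarrow> x \<curlywedge> y \<preceq> x"
  by (metis rle_def join_meet_absorb join_commute meet_closed)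

lemma (in residuated_lattice) meet_le2: "\<lbrakk>x \<in> carrier A; y \<in> carrier A\<rbrakk> \<Longrightarrow> x \<curlywedge> y \<preceq> y"
  by (metis meet_le1 meet_commute)

lemma (in residuated_lattice) meet_greatest:
  "\<lbrakk>z \<preceq> x; z \<preceq> y; x \<in> carrier A; y \<in> carrier A; z \<in> carrier A\<rbrakk> \<Longrightarrow> z \<preceq> x \<curlywedge> y"
  by (metis le_iff_meet meet_assoc meet_closed)

lemma (in residuated_lattice) imp_mp:
  "\<lbrakk>x \<in> carrier A; y \<in> carrier A\<rbrakk> \<Longrightarrow> (x \<rightharpoonup> y) \<otimes> x \<preceq> y"
  by (simp add: residuation imp_closed le_refl)

lemma (in residuated_lattice) mult_mono1:
  assumes "x \<preceq> y" "x \<in> carrier A" "y \<in> carrier A" "z \<in> carrier A"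
  shows "x \<otimes> z \<preceq> y \<otimes> z"
proof -
  have "y \<preceq> z \<rightharpoonup> y \<otimes> z"
    using assms residuation[of y z "y \<otimes> z"] by (simp add: le_refl)
  hence "x \<preceq> z \<rightharpoonup> y \<otimes> z"
    using assms by (meson le_trans imp_closed m_closed)
  thus ?thesis using assms by (simp add: residuation)
qed

lemma (in residuated_lattice) mult_mono2:
  "\<lbrakk>x \<preceq> y; x \<in> carrier A; y \<in> carrier A; z \<in> carrier A\<rbrakk> \<Longrightarrow> z \<otimes> x \<preceq> z \<otimes> y"
  by (simp add: mult_mono1 m_comm)

lemma (in residuated_lattice) mult_mono:
  "\<lbrakk>x \<preceq> y; u \<preceq> v; x \<in> carrier A; y \<in> carrier A; u \<in> carrier A; v \<in> carrier A\<rbrakk>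
    \<Longrightarrow> x \<otimes> u \<preceq> y \<otimes> v"
  by (meson le_trans mult_mono1 mult_mono2 m_closed)

lemma (in residuated_lattice) mult_le1: "\<lbrakk>x \<in> carrier A; y \<in> carrier A\<rbrakk> \<Longrightarrow> x \<otimes> y \<preceq> x"
  using mult_mono2[of y \<one> x] by (simp add: one_greatest)

lemma (in residuated_lattice) mult_le2: "\<lbrakk>x \<in> carrier A; y \<in> carrier A\<rbrakk> \<Longrightarrow> x \<otimes> y \<preceq> y"
  using mult_mono1[of x \<one> y] by (simp add: one_greatest)

lemma (in residuated_lattice) le_one_imp: "\<lbrakk>\<one> \<preceq> x; x \<in> carrier A\<rbrakk> \<Longrightarrow> x = \<one>"
  by (simp add: le_antisym one_greatest)

lemma (in residuated_lattice) mult_join_le: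
  assumes "h \<otimes> x \<preceq> z" "h \<otimes> y \<preceq> z" "h \<in> carrier A" "x \<in> carrier A" "y \<in> carrier A" "z \<in> carrier A"
  shows "h \<otimes> (x \<curlyvee> y) \<preceq> z"
proof -
  have "x \<preceq> h \<rightharpoonup> z" "y \<preceq> h \<rightharpoonup> z"
    using assms by (simp_all add: residuation[symmetric] m_comm)
  hence "x \<curlyvee> y \<preceq> h \<rightharpoonup> z" using assms by (simp add: join_least imp_closed)
  thus ?thesis using assms by (simp add: residuation[symmetric] m_comm join_closed)
qed

text \<open>
  Both factors are bounded by joins with the same element \<open>c\<close>, so expanding the product
  leaves \<open>x \<otimes> y\<close> and three terms below \<open>c\<close>. This inequality is what makes sets of the
  form \<open>{z. z \<curlyvee> c \<in> F}\<close>, and also \<open>D_set A P\<close>, closed under multiplication.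
\<close>

lemma (in residuated_lattice) join_mult_join_le:
  assumes "x \<in> carrier A" "y \<in> carrier A" "c \<in> carrier A"
  shows "(x \<curlyvee> c) \<otimes> (y \<curlyvee> c) \<preceq> (x \<otimes> y) \<curlyvee> c"
proof -
  note cl = assms m_closed join_closed
  have c: "c \<preceq> (x \<otimes> y) \<curlyvee> c" using cl by (simp add: le_join2)
  have xc: "x \<otimes> c \<preceq> (x \<otimes> y) \<curlyvee> c"
    using cl by (meson mult_le2 c le_trans)
  have xy: "x \<otimes> y \<preceq> (x \<otimes> y) \<curlyvee> c" using cl by (simp add: le_join1)
  have 1: "x \<otimes> (y \<curlyvee> c) \<preceq> (x \<otimes> y) \<curlyvee> c"
    using cl xy xc by (simp add: mult_join_le)
  have 2: "c \<otimes> (y \<curlyvee> c) \<preceq> (x \<otimes> y) \<curlyvee> c"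
    using cl by (meson mult_le1 c le_trans)
  have "(y \<curlyvee> c) \<otimes> (x \<curlyvee> c) \<preceq> (x \<otimes> y) \<curlyvee> c"
    using 1 2 cl by (intro mult_join_le) (simp_all add: m_comm)
  thus ?thesis using cl by (simp add: m_comm)
qed

section \<open>Filters and primeness\<close>

lemma (in residuated_lattice) filter_up:
  "\<lbrakk>rl_filter A F; x \<in> F; x \<preceq> y; y \<in> carrier A\<rbrakk> \<Longrightarrow> y \<in> F"
  unfolding rl_filter_def rle_def by metis

lemma (in residuated_lattice) filter_carrier: "\<lbrakk>rl_filter A F; x \<in> F\<rbrakk> \<Longrightarrow> x \<in> carrier A"
  unfolding rl_filter_def by auto

lemma (in residuated_lattice) filter_mult: "\<lbrakk>rl_filter A F; x \<in> F; y \<in> F\<rbrakk> \<Longrightarrow> x \<otimes> y \<in> F"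
  unfolding rl_filter_def by auto

lemma (in residuated_lattice) filter_one: "rl_filter A F \<Longrightarrow> \<one> \<in> F"
  by (metis ex_in_conv filter_up filter_carrier one_greatest one_closed rl_filter_def)

lemma (in residuated_lattice) filter_join1:
  "\<lbrakk>rl_filter A F; x \<in> F; y \<in> carrier A\<rbrakk> \<Longrightarrow> x \<curlyvee> y \<in> F"
  unfolding rl_filter_def by auto

lemma (in residuated_lattice) filter_join2:
  "\<lbrakk>rl_filter A F; y \<in> F; x \<in> carrier A\<rbrakk> \<Longrightarrow> x \<curlyvee> y \<in> F"
  by (metis filter_join1 join_commute filter_carrier)

lemma (in residuated_lattice) filterI:
  assumes "F \<subseteq> carrier A" "\<one> \<in> F" "\<And>x y. \<lbrakk>x \<in> F; y \<in> F\<rbrakk> \<Longrightarrow> x \<otimes> y \<in> F"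
    and "\<And>x y. \<lbrakk>x \<in> F; y \<in> carrier A; x \<preceq> y\<rbrakk> \<Longrightarrow> y \<in> F"
  shows "rl_filter A F"
proof -
  have "x \<curlyvee> y \<in> F" if x: "x \<in> F" and y: "y \<in> carrier A" for x y
  proof -
    have "x \<in> carrier A" using assms(1) x by blast
    thus ?thesis using assms(4)[OF x _ le_join1] y join_closed by blast
  qed
  thus ?thesis unfolding rl_filter_def using assms(1-3) by blast
qed

lemma (in residuated_lattice) proper_filter_iff:
  "proper_filter A F \<longleftrightarrow> rl_filter A F \<and> \<bottom>\<^sub>r \<notin> F"
proof -
  have "F = carrier A" if "rl_filter A F" "\<bottom>\<^sub>r \<in> F"
    using that filter_up[OF that(1,2)] bot_least filter_carrier by blast
  thus ?thesis unfolding proper_filter_def using bot_closed by blast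
qed

text \<open>
  This is the residual \<open>(F : X)\<close> with respect to join. In testing primeness it replaces the
  filter generated by \<open>F\<close> and an element, whose description would need powers of that element.
\<close>

lemma (in residuated_lattice) filter_residual:
  assumes F: "rl_filter A F" and X: "X \<subseteq> carrier A"
  shows "rl_filter A {z \<in> carrier A. \<forall>x\<in>X. z \<curlyvee> x \<in> F}"
proof (rule filterI, goal_cases)
  case 1
  show ?case by blast
next
  case 2
  show ?case using X one_greatest filter_up[OF F filter_one[OF F]]
    by (auto simp: join_closed le_join1 subset_iff)
next
  case (3 y z)
  have "(y \<otimes> z) \<curlyvee> x \<in> F" if "x \<in> X" for x
  proof -
    have "(y \<curlyvee> x) \<otimes> (z \<curlyvee> x) \<in> F" using 3 that F by (simp add: filter_mult)
    thus ?thesis using 3 that X F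
      by (intro filter_up[OF F _ join_mult_join_le]) (auto simp: join_closed)
  qed
  thus ?case using 3 by simp
next
  case (4 y z)
  have "z \<curlyvee> x \<in> F" if "x \<in> X" for x
  proof -
    have cx: "x \<in> carrier A" using that X by auto
    have "y \<curlyvee> x \<preceq> z \<curlyvee> x"
      using 4 cx by (auto intro: join_mono1)
    moreover have "y \<curlyvee> x \<in> F" using 4 that by auto
    ultimately show ?thesis using 4 cx filter_up[OF F] join_closed by blast
  qed
  thus ?case using 4 by simp
qed

text \<open>
  If \<open>x \<curlyvee> y \<in> P\<close>, then \<open>F = (P : y)\<close> contains \<open>x\<close>, the filter \<open>G = (P : F)\<close> contains
  \<open>y\<close>, and \<open>F \<inter> G = P\<close> because \<open>z = z \<curlyvee> z\<close>. So meet-irreducibility puts \<open>x\<close> or \<open>y\<close>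
  into \<open>P\<close>.
\<close>

lemma (in residuated_lattice) prime_filter_iff_join:
  "prime_filter A P \<longleftrightarrow> proper_filter A P \<and>
    (\<forall>x\<in>carrier A. \<forall>y\<in>carrier A. x \<curlyvee> y \<in> P \<longrightarrow> x \<in> P \<or> y \<in> P)"
proof (intro iffI conjI ballI impI)
  assume P: "prime_filter A P"
  thus "proper_filter A P" by (simp add: prime_filter_def)
  hence fP: "rl_filter A P" by (simp add: proper_filter_def)
  fix x y assume x: "x \<in> carrier A" and y: "y \<in> carrier A" and xy: "x \<curlyvee> y \<in> P"
  define F where "F = {z \<in> carrier A. \<forall>w\<in>{y}. z \<curlyvee> w \<in> P}"
  define G where "G = {z \<in> carrier A. \<forall>w\<in>F. z \<curlyvee> w \<in> P}"
  have F: "rl_filter A F" unfolding F_def using fP y by (intro filter_residual) auto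
  have G: "rl_filter A G" unfolding G_def using fP F filter_carrier
    by (intro filter_residual) auto
  have "x \<in> F" using x xy by (simp add: F_def)
  moreover have "y \<in> G" using y unfolding G_def F_def by (auto simp: join_commute)
  moreover have "F \<inter> G = P"
  proof
    have "z \<curlyvee> z \<in> P" "z \<in> carrier A" if "z \<in> F \<inter> G" for z
      using that by (auto simp: G_def)
    thus "F \<inter> G \<subseteq> P" by (auto simp: join_idem)
    have "z \<in> F \<inter> G" if z: "z \<in> P" for z
      using filter_carrier[OF fP z] filter_join1[OF fP z] y by (auto simp: F_def G_def)
    thus "P \<subseteq> F \<inter> G" by blast
  qed
  ultimately show "x \<in> P \<or> y \<in> P"
    using P F G unfolding prime_filter_def by metis
next
  assume *: "proper_filter A P \<and>
    (\<forall>x\<in>carrier A. \<forall>y\<in>carrier A. x \<curlyvee> y \<in> P \<longrightarrow> x \<in> P \<or> y \<in> P)"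
  have "F = P \<or> G = P" if F: "rl_filter A F" and G: "rl_filter A G" and FG: "F \<inter> G = P" for F G
  proof (rule ccontr)
    assume "\<not> (F = P \<or> G = P)"
    then obtain x y where xy: "x \<in> F" "x \<notin> P" "y \<in> G" "y \<notin> P" using FG by blast
    have "x \<curlyvee> y \<in> P" using xy F G FG filter_join1 filter_join2 filter_carrier by blast
    thus False using * xy F G filter_carrier by blast
  qed
  thus "prime_filter A P" using * unfolding prime_filter_def by blast
qed

lemma (in residuated_lattice) prime_filter_proper:
  "prime_filter A P \<Longrightarrow> rl_filter A P" "prime_filter A P \<Longrightarrow> \<bottom>\<^sub>r \<notin> P"
  by (simp_all add: prime_filter_def proper_filter_iff)

lemma (in residuated_lattice) prime_filter_joinD:
  "\<lbrakk>prime_filter A P; x \<curlyvee> y \<in> P; x \<in> carrier A; y \<in> carrier A\<rbrakk> \<Longrightarrow> x \<in> P \<or> y \<in> P"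
  unfolding prime_filter_iff_join by blast

section \<open>Maximal filters avoiding a set\<close>

lemma (in residuated_lattice) filter_Union_chain:
  assumes "C \<noteq> {}" "\<And>F. F \<in> C \<Longrightarrow> rl_filter A F"
    and chain: "\<And>F G. \<lbrakk>F \<in> C; G \<in> C\<rbrakk> \<Longrightarrow> F \<subseteq> G \<or> G \<subseteq> F"
  shows "rl_filter A (\<Union>C)"
proof (rule filterI)
  show "\<one> \<in> \<Union>C" using assms(1) filter_one[OF assms(2)] by blast
  show "\<Union>C \<subseteq> carrier A" using filter_carrier[OF assms(2)] by blast
next
  fix x y assume "x \<in> \<Union>C" "y \<in> \<Union>C"
  then obtain F G where FG: "F \<in> C" "G \<in> C" "x \<in> F" "y \<in> G" by auto
  then obtain H where "H \<in> C" "x \<in> H" "y \<in> H" using chain[of F G] by auto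
  thus "x \<otimes> y \<in> \<Union>C" using assms(2) filter_mult by blast
next
  fix x y assume "x \<in> \<Union>C" and y: "y \<in> carrier A" "x \<preceq> y"
  then obtain F where "F \<in> C" "x \<in> F" by auto
  thus "y \<in> \<Union>C" using filter_up[OF assms(2) _ y(2,1)] by auto
qed

lemma (in residuated_lattice) maximal_avoiding_filter_exists:
  assumes "rl_filter A F" "F \<inter> S = {}"
  obtains M where "rl_filter A M" "M \<inter> S = {}" "F \<subseteq> M"
    "\<And>G. \<lbrakk>rl_filter A G; G \<inter> S = {}; M \<subseteq> G\<rbrakk> \<Longrightarrow> G = M"
proof -
  let ?Fs = "{G. rl_filter A G \<and> G \<inter> S = {} \<and> F \<subseteq> G}"
  have "\<exists>M\<in>?Fs. \<forall>G\<in>?Fs. M \<subseteq> G \<longrightarrow> G = M"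
  proof (rule subset_Zorn_nonempty)
    show "?Fs \<noteq> {}" using assms by blast
    fix C assume "C \<noteq> {}" and C: "subset.chain ?Fs C"
    hence "rl_filter A (\<Union>C)"
      by (intro filter_Union_chain) (auto simp: subset_chain_def)
    thus "\<Union>C \<in> ?Fs" using C \<open>C \<noteq> {}\<close> by (auto simp: subset_chain_def)
  qed
  then obtain M where M: "M \<in> ?Fs" and max: "\<forall>G\<in>?Fs. M \<subseteq> G \<longrightarrow> G = M" by (rule bexE)
  show ?thesis
  proof (rule that[of M])
    fix G assume "rl_filter A G" "G \<inter> S = {}" "M \<subseteq> G"
    thus "G = M" using max M by blast
  qed (use M in simp_all)
qed

text \<open>
  A filter maximal among those avoiding a join-closed set is prime: if it were \<open>F \<inter> G\<close> with
  two strictly larger filters, these would meet the set in points \<open>s\<close> and \<open>t\<close>, and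
  \<open>s \<curlyvee> t\<close> would lie in \<open>F \<inter> G\<close> and in the set.
\<close>

lemma (in residuated_lattice) prime_avoiding_filter_exists:
  assumes F: "rl_filter A F" "F \<inter> S = {}" and S: "S \<noteq> {}" "S \<subseteq> carrier A"
    and join: "\<And>s t. \<lbrakk>s \<in> S; t \<in> S\<rbrakk> \<Longrightarrow> s \<curlyvee> t \<in> S"
  obtains M where "prime_filter A M" "M \<inter> S = {}"
proof -
  obtain M where M: "rl_filter A M" "M \<inter> S = {}" "F \<subseteq> M"
    and max: "\<And>G. \<lbrakk>rl_filter A G; G \<inter> S = {}; M \<subseteq> G\<rbrakk> \<Longrightarrow> G = M"
    using maximal_avoiding_filter_exists[OF F] by blast
  have irred: "H = M \<or> G = M" if H: "rl_filter A H" "rl_filter A G" "H \<inter> G = M" for H G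
  proof (rule ccontr)
    assume "\<not> (H = M \<or> G = M)"
    then obtain s t where "s \<in> S" "s \<in> H" "t \<in> S" "t \<in> G" using max H by blast
    hence "s \<curlyvee> t \<in> M" "s \<curlyvee> t \<in> S"
      using H S filter_join1 filter_join2 join by blast+
    thus False using M by blast
  qed
  have "M \<noteq> carrier A" using M S by blast
  hence "prime_filter A M"
    using M(1) irred unfolding prime_filter_def proper_filter_def by simp
  thus ?thesis using M(2) by (rule that)
qed

lemma (in residuated_lattice) maximal_filter_above:
  assumes "proper_filter A F"
  obtains M where "maximal_filter A M" "F \<subseteq> M"
proof -
  obtain M where "rl_filter A M" "M \<inter> {\<bottom>\<^sub>r} = {}" "F \<subseteq> M"
    "\<And>G. \<lbrakk>rl_filter A G; G \<inter> {\<bottom>\<^sub>r} = {}; M \<subseteq> G\<rbrakk> \<Longrightarrow> G = M"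
    using maximal_avoiding_filter_exists[of F "{\<bottom>\<^sub>r}"] assms
    by (auto simp: proper_filter_iff)
  thus ?thesis using that[of M] by (auto simp: maximal_filter_def proper_filter_iff)
qed

lemma maximal_filter_prime: "maximal_filter A M \<Longrightarrow> prime_filter A M"
  unfolding maximal_filter_def prime_filter_def proper_filter_def by blast

section \<open>The filter of divisors at a prime filter\<close>

text \<open>
  Primeness of \<open>P\<close> keeps the join of two witnesses outside \<open>P\<close>, and this join is a common
  witness for both factors of a product, hence for the product by \<open>join_mult_join_le\<close>.
\<close>

lemma (in residuated_lattice) D_set_filter:
  assumes P: "prime_filter A P"
  shows "rl_filter A (D_set A P)"
proof (rule filterI)
  show "D_set A P \<subseteq> carrier A" by (auto simp: D_set_def)
  show "\<one> \<in> D_set A P" unfolding D_set_def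
    using prime_filter_proper[OF P] bot_closed le_join1[of \<one> "\<bottom>\<^sub>r"]
    by (auto intro!: bexI[of _ "\<bottom>\<^sub>r"] le_one_imp join_closed)
next
  fix a b assume "a \<in> D_set A P" "b \<in> D_set A P"
  then obtain x y where a: "a \<in> carrier A" "x \<in> carrier A" "x \<notin> P" "a \<curlyvee> x = \<one>"
    and b: "b \<in> carrier A" "y \<in> carrier A" "y \<notin> P" "b \<curlyvee> y = \<one>"
    by (auto simp: D_set_def)
  have c: "x \<curlyvee> y \<in> carrier A" using a b by (simp add: join_closed)
  have "a \<curlyvee> (x \<curlyvee> y) = \<one>"
    using a b c by (metis join_assoc join_closed le_join1 le_one_imp)
  moreover have "b \<curlyvee> (x \<curlyvee> y) = \<one>"
    using a b c by (metis join_assoc join_closed join_commute le_join1 le_one_imp)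
  ultimately have "\<one> \<preceq> (a \<otimes> b) \<curlyvee> (x \<curlyvee> y)"
    using join_mult_join_le[of a b "x \<curlyvee> y"] a b c by simp
  hence "(a \<otimes> b) \<curlyvee> (x \<curlyvee> y) = \<one>" using a b c by (simp add: le_one_imp join_closed)
  moreover have "x \<curlyvee> y \<notin> P" using prime_filter_joinD[OF P] a b by blast
  ultimately show "a \<otimes> b \<in> D_set A P" using a b c by (auto simp: D_set_def)
next
  fix a b assume "a \<in> D_set A P" and b: "b \<in> carrier A" "a \<preceq> b"
  then obtain x where a: "a \<in> carrier A" "x \<in> carrier A" "x \<notin> P" "a \<curlyvee> x = \<one>"
    by (auto simp: D_set_def)
  have "a \<curlyvee> x \<preceq> b \<curlyvee> x"
    using join_mono1[OF b(2) a(1) b(1) a(2)] .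
  hence "b \<curlyvee> x = \<one>" using a b by (simp add: le_one_imp join_closed)
  thus "b \<in> D_set A P" using a b by (auto simp: D_set_def)
qed

lemma (in residuated_lattice) D_set_subset_prime:
  assumes Q: "prime_filter A Q" and "Q \<subseteq> P"
  shows "D_set A P \<subseteq> Q"
proof
  fix a assume "a \<in> D_set A P"
  then obtain x where "a \<in> carrier A" "x \<in> carrier A" "x \<notin> P" "a \<curlyvee> x = \<one>"
    by (auto simp: D_set_def)
  thus "a \<in> Q"
    using prime_filter_joinD[OF Q, of a x] filter_one[OF prime_filter_proper(1)[OF Q]] assms(2)
    by auto
qed

text \<open>
  Let \<open>S\<close> consist of the joins of \<open>a\<close> with elements outside \<open>P\<close>. It is join-closed because
  \<open>P\<close> is prime, and it misses \<open>1\<close> because \<open>a\<close> is not in \<open>D_set A P\<close>. So some prime filter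
  \<open>R\<close> avoids \<open>S\<close>. An element of \<open>R\<close> outside \<open>P\<close> would put its join with \<open>a\<close> into
  \<open>R \<inter> S\<close>, and \<open>a\<close> itself is \<open>a \<curlyvee> \<bottom>\<^sub>r\<close>, an element of \<open>S\<close>.
\<close>

lemma (in residuated_lattice) prime_filter_omitting:
  assumes P: "prime_filter A P" and a: "a \<in> carrier A" "a \<notin> D_set A P"
  obtains R where "prime_filter A R" "R \<subseteq> P" "a \<notin> R"
proof -
  define S where "S = {a \<curlyvee> x | x. x \<in> carrier A - P}"
  note bot = prime_filter_proper(2)[OF P]
  have triv: "rl_filter A {\<one>}"
    using le_one_imp by (intro filterI) auto
  have "{\<one>} \<inter> S = {}" using a unfolding S_def D_set_def by auto
  moreover have "S \<noteq> {}" "S \<subseteq> carrier A"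
    using bot bot_closed a by (auto simp: S_def join_closed)
  moreover have "s \<curlyvee> t \<in> S" if st: "s \<in> S" "t \<in> S" for s t
  proof -
    obtain x y where xy: "x \<in> carrier A" "x \<notin> P" "y \<in> carrier A" "y \<notin> P"
      and s: "s = a \<curlyvee> x" and t: "t = a \<curlyvee> y"
      using st by (auto simp: S_def)
    have "s \<curlyvee> t = a \<curlyvee> (x \<curlyvee> y)"
      unfolding s t using xy a by (metis join_assoc join_commute join_idem join_closed)
    moreover have "x \<curlyvee> y \<in> carrier A - P"
      using xy prime_filter_joinD[OF P] by (auto simp: join_closed)
    ultimately show ?thesis unfolding S_def by blast
  qed
  ultimately obtain R where R: "prime_filter A R" "R \<inter> S = {}"
    using prime_avoiding_filter_exists[OF triv, of S] by blast
  note fR = prime_filter_proper(1)[OF R(1)]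
  have "R \<subseteq> P"
    using R a fR filter_join2 filter_carrier unfolding S_def by blast
  moreover have "a \<notin> R"
    using R fR bot bot_closed filter_join1 unfolding S_def by blast
  ultimately show ?thesis by (rule that[OF R(1)])
qed

text \<open>
  An element of the unique minimal prime \<open>Q\<close> below \<open>P\<close> lies in every prime filter inside \<open>P\<close>,
  since each of these contains a minimal prime, which can only be \<open>Q\<close>. Hence \<open>Q\<close> is contained
  in the intersection \<open>D_set A P\<close> of these prime filters.
\<close>

lemma (in residuated_lattice) mp_D_set_prime:
  assumes mp: "mp_residuated_lattice A" and P: "prime_filter A P"
  shows "prime_filter A (D_set A P)"
proof -
  obtain Q where Q: "prime_filter A Q" "Q \<subseteq> P"
    and uniq: "\<And>Q'. \<lbrakk>minimal_prime_filter A Q'; Q' \<subseteq> P\<rbrakk> \<Longrightarrow> Q' = Q"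
    using mp P unfolding mp_residuated_lattice_def by (metis minimal_prime_filter_def)
  have "Q \<subseteq> D_set A P"
  proof (rule subsetI, rule ccontr)
    fix a assume "a \<in> Q" "a \<notin> D_set A P"
    then obtain R where R: "prime_filter A R" "R \<subseteq> P" "a \<notin> R"
      using prime_filter_omitting[OF P] filter_carrier prime_filter_proper(1)[OF Q(1)] by metis
    obtain Q' where "minimal_prime_filter A Q'" "Q' \<subseteq> R"
      using mp R(1) unfolding mp_residuated_lattice_def by metis
    thus False using uniq R \<open>a \<in> Q\<close> by blast
  qed
  hence "D_set A P = Q" using D_set_subset_prime[OF Q] by blast
  thus ?thesis using Q by simp
qed

text \<open>
  For a maximal filter \<open>M\<close> above \<open>P\<close>, the set \<open>D_set A M\<close> is contained in every prime filter
  below \<open>M\<close>. So once it is itself prime, it is the least one, hence the only minimal one.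
\<close>

lemma (in residuated_lattice) mp_if_maximal_D_set_prime:
  assumes D: "\<And>M. maximal_filter A M \<Longrightarrow> prime_filter A (D_set A M)"
  shows "mp_residuated_lattice A"
  unfolding mp_residuated_lattice_def
proof (intro conjI allI impI)
  show "residuated_lattice A" by (rule residuated_lattice_axioms)
  fix P assume P: "prime_filter A P"
  obtain M where M: "maximal_filter A M" "P \<subseteq> M"
    using maximal_filter_above[of P] P unfolding prime_filter_def by metis
  have least: "D_set A M \<subseteq> Q" if "prime_filter A Q" "Q \<subseteq> M" for Q
    using that by (rule D_set_subset_prime)
  have DP: "D_set A M \<subseteq> P" using P M by (intro least)
  hence "minimal_prime_filter A (D_set A M)"
    unfolding minimal_prime_filter_def using D[OF M(1)] M least by blast
  moreover have "Q = D_set A M" if "minimal_prime_filter A Q \<and> Q \<subseteq> P" for Q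
    using that least[of Q] D[OF M(1)] M unfolding minimal_prime_filter_def by blast
  ultimately show "\<exists>!Q. minimal_prime_filter A Q \<and> Q \<subseteq> P" using DP by blast
qed

section \<open>The quotient by a filter\<close>

text \<open>
  The relation \<open>x \<rightharpoonup> y \<in> F\<close> is a preorder whose symmetric part is \<open>filter_cong A F\<close>, and it
  holds as soon as \<open>f \<otimes> x \<preceq> y\<close> for one \<open>f \<in> F\<close>. Each operation is monotone for it
  (implication antitone on the left), which yields both that \<open>filter_cong A F\<close> is a
  congruence and that this preorder induces the order of the quotient.
\<close>

lemma (in residuated_lattice) imp_in_filterI:
  assumes F: "rl_filter A F" and "f \<in> F" "f \<otimes> x \<preceq> y" "x \<in> carrier A" "y \<in> carrier A"
  shows "x \<rightharpoonup> y \<in> F"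
  using assms filter_carrier[OF F] filter_up[OF F, of f "x \<rightharpoonup> y"]
  by (simp add: residuation imp_closed)

lemma (in residuated_lattice) imp_in_filter_if_le:
  "\<lbrakk>rl_filter A F; x \<preceq> y; x \<in> carrier A; y \<in> carrier A\<rbrakk> \<Longrightarrow> x \<rightharpoonup> y \<in> F"
  by (rule imp_in_filterI[of F \<one>]) (simp_all add: filter_one)

lemma (in residuated_lattice) filter_imp_trans:
  assumes F: "rl_filter A F" and xy: "x \<rightharpoonup> y \<in> F" and yz: "y \<rightharpoonup> z \<in> F"
    and c: "x \<in> carrier A" "y \<in> carrier A" "z \<in> carrier A"
  shows "x \<rightharpoonup> z \<in> F"
proof (rule imp_in_filterI[OF F filter_mult[OF F yz xy] _ c(1,3)])
  have "(y \<rightharpoonup> z) \<otimes> ((x \<rightharpoonup> y) \<otimes> x) \<preceq> (y \<rightharpoonup> z) \<otimes> y"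
    using c by (intro mult_mono2 imp_mp) (auto simp: imp_closed)
  thus "(y \<rightharpoonup> z) \<otimes> (x \<rightharpoonup> y) \<otimes> x \<preceq> z"
    using c imp_mp[of y z] by (simp add: m_assoc imp_closed) (meson le_trans imp_closed m_closed)
qed

lemma (in residuated_lattice) filter_imp_mult:
  assumes F: "rl_filter A F" and xy: "x \<rightharpoonup> y \<in> F" and uv: "u \<rightharpoonup> v \<in> F"
    and c: "x \<in> carrier A" "y \<in> carrier A" "u \<in> carrier A" "v \<in> carrier A"
  shows "x \<otimes> u \<rightharpoonup> y \<otimes> v \<in> F"
proof (rule imp_in_filterI[OF F filter_mult[OF F xy uv]])
  have "((x \<rightharpoonup> y) \<otimes> x) \<otimes> ((u \<rightharpoonup> v) \<otimes> u) \<preceq> y \<otimes> v"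
    using c by (intro mult_mono imp_mp) (auto simp: imp_closed)
  thus "(x \<rightharpoonup> y) \<otimes> (u \<rightharpoonup> v) \<otimes> (x \<otimes> u) \<preceq> y \<otimes> v"
    using c by (simp add: m_ac imp_closed)
qed (use c in auto)

lemma (in residuated_lattice) filter_imp_join:
  assumes F: "rl_filter A F" and xy: "x \<rightharpoonup> y \<in> F" and uv: "u \<rightharpoonup> v \<in> F"
    and c: "x \<in> carrier A" "y \<in> carrier A" "u \<in> carrier A" "v \<in> carrier A"
  shows "x \<curlyvee> u \<rightharpoonup> y \<curlyvee> v \<in> F"
proof (rule imp_in_filterI[OF F filter_mult[OF F xy uv]])
  note cl = c imp_closed join_closed m_closed
  have "(x \<rightharpoonup> y) \<otimes> (u \<rightharpoonup> v) \<otimes> x \<preceq> y \<curlyvee> v"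
    using cl mult_mono1[OF mult_le1[of "x \<rightharpoonup> y" "u \<rightharpoonup> v"], of x] imp_mp[of x y] le_join1[of y v]
    by (meson le_trans)
  moreover have "(x \<rightharpoonup> y) \<otimes> (u \<rightharpoonup> v) \<otimes> u \<preceq> y \<curlyvee> v"
    using cl mult_mono1[OF mult_le2[of "x \<rightharpoonup> y" "u \<rightharpoonup> v"], of u] imp_mp[of u v] le_join2[of y v]
    by (meson le_trans)
  ultimately show "(x \<rightharpoonup> y) \<otimes> (u \<rightharpoonup> v) \<otimes> (x \<curlyvee> u) \<preceq> y \<curlyvee> v"
    using cl by (intro mult_join_le) auto
qed (use c in \<open>auto simp: join_closed\<close>)

lemma (in residuated_lattice) filter_imp_meet:
  assumes F: "rl_filter A F" and xy: "x \<rightharpoonup> y \<in> F" and uv: "u \<rightharpoonup> v \<in> F"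
    and c: "x \<in> carrier A" "y \<in> carrier A" "u \<in> carrier A" "v \<in> carrier A"
  shows "x \<curlywedge> u \<rightharpoonup> y \<curlywedge> v \<in> F"
proof (rule imp_in_filterI[OF F filter_mult[OF F xy uv]])
  note cl = c imp_closed meet_closed m_closed
  have "(x \<rightharpoonup> y) \<otimes> (u \<rightharpoonup> v) \<otimes> (x \<curlywedge> u) \<preceq> (x \<rightharpoonup> y) \<otimes> x"
    using cl by (intro mult_mono mult_le1 meet_le1) auto
  hence 1: "(x \<rightharpoonup> y) \<otimes> (u \<rightharpoonup> v) \<otimes> (x \<curlywedge> u) \<preceq> y"
    using cl imp_mp[of x y] by (meson le_trans)
  have "(x \<rightharpoonup> y) \<otimes> (u \<rightharpoonup> v) \<otimes> (x \<curlywedge> u) \<preceq> (u \<rightharpoonup> v) \<otimes> u"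
    using cl by (intro mult_mono mult_le2 meet_le2) auto
  hence "(x \<rightharpoonup> y) \<otimes> (u \<rightharpoonup> v) \<otimes> (x \<curlywedge> u) \<preceq> v"
    using cl imp_mp[of u v] by (meson le_trans)
  thus "(x \<rightharpoonup> y) \<otimes> (u \<rightharpoonup> v) \<otimes> (x \<curlywedge> u) \<preceq> y \<curlywedge> v"
    using 1 cl by (intro meet_greatest) auto
qed (use c in \<open>auto simp: meet_closed\<close>)

lemma (in residuated_lattice) mult_imp_eq:
  assumes c: "x \<in> carrier A" "y \<in> carrier A" "z \<in> carrier A"
  shows "(x \<otimes> y) \<rightharpoonup> z = x \<rightharpoonup> (y \<rightharpoonup> z)"
proof (rule le_antisym)
  note cl = c imp_closed m_closed
  have "((x \<otimes> y) \<rightharpoonup> z) \<otimes> (x \<otimes> y) \<preceq> z" using cl by (intro imp_mp) auto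
  thus "(x \<otimes> y) \<rightharpoonup> z \<preceq> x \<rightharpoonup> (y \<rightharpoonup> z)"
    using cl by (simp add: residuation[symmetric] m_assoc)
  have "(x \<rightharpoonup> (y \<rightharpoonup> z)) \<otimes> x \<preceq> y \<rightharpoonup> z" using cl by (intro imp_mp) auto
  thus "x \<rightharpoonup> (y \<rightharpoonup> z) \<preceq> (x \<otimes> y) \<rightharpoonup> z"
    using cl by (simp add: residuation[symmetric] m_assoc)
qed (use c in \<open>auto simp: imp_closed\<close>)

lemma (in residuated_lattice) one_imp: "x \<in> carrier A \<Longrightarrow> \<one> \<rightharpoonup> x = x"
  using imp_mp[of \<one> x] residuation[of x \<one> x]
  by (simp add: imp_closed le_antisym le_refl)

text \<open>
  By currying it suffices to go from \<open>(x \<rightharpoonup> u) \<otimes> y\<close> to \<open>v\<close>, which passes through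
  \<open>(x \<rightharpoonup> u) \<otimes> x\<close> and then \<open>u\<close>.
\<close>

lemma (in residuated_lattice) filter_imp_imp:
  assumes F: "rl_filter A F" and yx: "y \<rightharpoonup> x \<in> F" and uv: "u \<rightharpoonup> v \<in> F"
    and c: "x \<in> carrier A" "y \<in> carrier A" "u \<in> carrier A" "v \<in> carrier A"
  shows "(x \<rightharpoonup> u) \<rightharpoonup> (y \<rightharpoonup> v) \<in> F"
proof -
  note cl = c imp_closed m_closed
  have "(x \<rightharpoonup> u) \<otimes> y \<rightharpoonup> (x \<rightharpoonup> u) \<otimes> x \<in> F"
    using F yx cl by (intro filter_imp_mult) (auto intro: imp_in_filter_if_le le_refl)
  moreover have "(x \<rightharpoonup> u) \<otimes> x \<rightharpoonup> u \<in> F"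
    using F cl by (intro imp_in_filter_if_le imp_mp) auto
  ultimately have "(x \<rightharpoonup> u) \<otimes> y \<rightharpoonup> v \<in> F"
    using F uv cl by (meson filter_imp_trans)
  thus ?thesis using cl by (simp add: mult_imp_eq)
qed

lemma (in residuated_lattice) filter_cong_equiv:
  assumes F: "rl_filter A F"
  shows "equiv (carrier A) (filter_cong A F)"
proof (rule equivI)
  show "refl_on (carrier A) (filter_cong A F)"
    using F by (auto simp: refl_on_def filter_cong_def intro: imp_in_filter_if_le le_refl)
  show "sym (filter_cong A F)" by (auto simp: sym_def filter_cong_def)
  show "trans (filter_cong A F)"
    using filter_imp_trans[OF F] unfolding trans_def filter_cong_def by blast
qed (auto simp: filter_cong_def)

abbreviation filter_class ::
  "('a, 'b) residuated_lattice_scheme \<Rightarrow> 'a set \<Rightarrow> 'a \<Rightarrow> 'a set"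
  where "filter_class A F x \<equiv> filter_cong A F `` {x}"

lemma (in residuated_lattice) filter_class_eq_iff:
  assumes "rl_filter A F" "x \<in> carrier A" "y \<in> carrier A"
  shows "filter_class A F x = filter_class A F y \<longleftrightarrow> x \<rightharpoonup> y \<in> F \<and> y \<rightharpoonup> x \<in> F"
  using eq_equiv_class_iff[OF filter_cong_equiv[OF assms(1)] assms(2,3)] assms
  by (simp add: filter_cong_def)

lemma (in residuated_lattice) class_eq_one_iff:
  assumes F: "rl_filter A F" and x: "x \<in> carrier A"
  shows "filter_class A F x = filter_class A F \<one> \<longleftrightarrow> x \<in> F"
  using assms by (simp add: filter_class_eq_iff one_imp imp_in_filter_if_le one_greatest)

lemma (in residuated_lattice) quotient_ops:
  assumes F: "rl_filter A F" and c: "x \<in> carrier A" "y \<in> carrier A"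
  shows
    "filter_class A F x \<otimes>\<^bsub>A //\<^sub>r F\<^esub> filter_class A F y = filter_class A F (x \<otimes> y)"
    "filter_class A F x \<curlyvee>\<^bsub>A //\<^sub>r F\<^esub> filter_class A F y = filter_class A F (x \<curlyvee> y)"
    "filter_class A F x \<curlywedge>\<^bsub>A //\<^sub>r F\<^esub> filter_class A F y = filter_class A F (x \<curlywedge> y)"
    "filter_class A F x \<rightharpoonup>\<^bsub>A //\<^sub>r F\<^esub> filter_class A F y = filter_class A F (x \<rightharpoonup> y)"
proof -
  \<comment> \<open>An operation monotone or antitone in each argument satisfies \<open>hF\<close>; antitone arguments use the
     reversed implications.\<close>
  have *: "(\<Union>x'\<in>filter_class A F x. \<Union>y'\<in>filter_class A F y. filter_class A F (h x' y'))
      = filter_class A F (h x y)"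
    if h: "\<And>x y. \<lbrakk>x \<in> carrier A; y \<in> carrier A\<rbrakk> \<Longrightarrow> h x y \<in> carrier A"
      and hF: "\<And>x y u v. \<lbrakk>x \<rightharpoonup> y \<in> F; y \<rightharpoonup> x \<in> F; u \<rightharpoonup> v \<in> F; v \<rightharpoonup> u \<in> F;
        x \<in> carrier A; y \<in> carrier A; u \<in> carrier A; v \<in> carrier A\<rbrakk> \<Longrightarrow> h x u \<rightharpoonup> h y v \<in> F"
    for h
  proof (rule UN_equiv_class2[OF filter_cong_equiv[OF F] filter_cong_equiv[OF F] _ c])
    have "filter_class A F (h x u) = filter_class A F (h y v)"
      if "(x, y) \<in> filter_cong A F" "(u, v) \<in> filter_cong A F" for x y u v
    proof -
      from that have "x \<in> carrier A" "y \<in> carrier A" "x \<rightharpoonup> y \<in> F" "y \<rightharpoonup> x \<in> F"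
        "u \<in> carrier A" "v \<in> carrier A" "u \<rightharpoonup> v \<in> F" "v \<rightharpoonup> u \<in> F"
        by (simp_all add: filter_cong_def)
      thus ?thesis using filter_class_eq_iff[OF F h h, of x u y v] hF[of x y u v] hF[of y x v u]
        by simp
    qed
    thus "congruent2 (filter_cong A F) (filter_cong A F) (\<lambda>x' y'. filter_class A F (h x' y'))"
      by (intro congruent2I') blast
  qed
  show "filter_class A F x \<otimes>\<^bsub>A //\<^sub>r F\<^esub> filter_class A F y = filter_class A F (x \<otimes> y)"
    unfolding rl_quotient_def by simp (rule *, simp_all add: filter_imp_mult F)
  show "filter_class A F x \<curlyvee>\<^bsub>A //\<^sub>r F\<^esub> filter_class A F y = filter_class A F (x \<curlyvee> y)"
    unfolding rl_quotient_def by simp (rule *, simp_all add: filter_imp_join F join_closed)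
  show "filter_class A F x \<curlywedge>\<^bsub>A //\<^sub>r F\<^esub> filter_class A F y = filter_class A F (x \<curlywedge> y)"
    unfolding rl_quotient_def by simp (rule *, simp_all add: filter_imp_meet F meet_closed)
  show "filter_class A F x \<rightharpoonup>\<^bsub>A //\<^sub>r F\<^esub> filter_class A F y = filter_class A F (x \<rightharpoonup> y)"
    unfolding rl_quotient_def by simp (rule *, simp_all add: filter_imp_imp F imp_closed)
qed

lemma rl_quotient_simps:
  "carrier (A //\<^sub>r F) = filter_class A F ` carrier A"
  "\<one>\<^bsub>A //\<^sub>r F\<^esub> = filter_class A F \<one>\<^bsub>A\<^esub>"
  "\<bottom>\<^sub>r\<^bsub>A //\<^sub>r F\<^esub> = filter_class A F \<bottom>\<^sub>r\<^bsub>A\<^esub>"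
  by (auto simp: rl_quotient_def quotient_def)

lemma (in residuated_lattice) quotient_le_iff:
  assumes F: "rl_filter A F" and c: "x \<in> carrier A" "y \<in> carrier A"
  shows "filter_class A F x \<preceq>\<^bsub>A //\<^sub>r F\<^esub> filter_class A F y \<longleftrightarrow> x \<rightharpoonup> y \<in> F"
proof -
  note cl = c imp_closed join_closed
  have "y \<rightharpoonup> x \<curlyvee> y \<in> F" using F cl by (intro imp_in_filter_if_le le_join2) auto
  moreover have "x \<curlyvee> y \<rightharpoonup> y \<in> F \<longleftrightarrow> x \<rightharpoonup> y \<in> F"
  proof
    assume "x \<curlyvee> y \<rightharpoonup> y \<in> F"
    moreover have "x \<rightharpoonup> x \<curlyvee> y \<in> F" using F cl by (intro imp_in_filter_if_le le_join1) auto
    ultimately show "x \<rightharpoonup> y \<in> F" using F cl by (meson filter_imp_trans)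
  next
    assume "x \<rightharpoonup> y \<in> F"
    thus "x \<curlyvee> y \<rightharpoonup> y \<in> F"
      using filter_imp_join[OF F _ imp_in_filter_if_le[OF F le_refl], of x y y] cl
      by (simp add: join_idem)
  qed
  ultimately show ?thesis
    using F cl by (simp add: rle_def quotient_ops filter_class_eq_iff)
qed

lemma (in residuated_lattice) quotient_residuated_lattice:
  assumes F: "rl_filter A F"
  shows "residuated_lattice (A //\<^sub>r F)"
proof -
  note s = rl_quotient_simps quotient_ops[OF F]
  have cm: "comm_monoid (A //\<^sub>r F)"
    by (rule comm_monoidI) (auto simp: s m_ac)
  show ?thesis
  proof (intro residuated_lattice.intro[OF cm] residuated_lattice_axioms.intro, goal_cases)
    case (5 x y) thus ?case by (auto simp: s join_commute)
  next
    case (6 x y) thus ?case by (auto simp: s meet_commute)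
  next
    case (11 x) thus ?case
      by (auto simp: s quotient_le_iff[OF F] bot_closed bot_least F imp_in_filter_if_le)
  next
    case (12 x) thus ?case
      by (auto simp: s quotient_le_iff[OF F] one_greatest F imp_in_filter_if_le)
  next
    case (13 x y z) thus ?case
      by (auto simp: s quotient_le_iff[OF F] imp_closed mult_imp_eq)
  qed (auto simp: s join_closed meet_closed imp_closed bot_closed join_assoc meet_assoc
      join_meet_absorb meet_join_absorb)
qed

text \<open>
  Since the class of \<open>a\<close> is \<open>1\<close> exactly when \<open>a \<in> F\<close>, a pair of classes with join \<open>1\<close> is a
  pair of elements with join in \<open>F\<close>: having no unit divisor but \<open>1\<close> is primeness of \<open>F\<close>,
  and non-degeneracy is properness.
\<close>

lemma (in residuated_lattice) quotient_domain_iff_prime: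
  assumes F: "rl_filter A F"
  shows "rl_domain (A //\<^sub>r F) \<longleftrightarrow> prime_filter A F"
proof -
  let ?B = "A //\<^sub>r F"
  have "(\<forall>a\<in>unit_divisors ?B. a = \<one>\<^bsub>?B\<^esub>) \<longleftrightarrow>
      (\<forall>X\<in>carrier ?B. \<forall>Y\<in>carrier ?B. X \<curlyvee>\<^bsub>?B\<^esub> Y = \<one>\<^bsub>?B\<^esub> \<longrightarrow> X = \<one>\<^bsub>?B\<^esub> \<or> Y = \<one>\<^bsub>?B\<^esub>)"
    unfolding unit_divisors_def D_set_def by blast
  also have "\<dots> \<longleftrightarrow>
      (\<forall>x\<in>carrier A. \<forall>y\<in>carrier A. x \<curlyvee> y \<in> F \<longrightarrow> x \<in> F \<or> y \<in> F)"
    by (simp add: rl_quotient_simps quotient_ops[OF F] class_eq_one_iff[OF F] join_closed)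
  finally have "(\<forall>a\<in>unit_divisors ?B. a = \<one>\<^bsub>?B\<^esub>) \<longleftrightarrow>
      (\<forall>x\<in>carrier A. \<forall>y\<in>carrier A. x \<curlyvee> y \<in> F \<longrightarrow> x \<in> F \<or> y \<in> F)" .
  moreover have "\<bottom>\<^sub>r\<^bsub>A //\<^sub>r F\<^esub> \<noteq> \<one>\<^bsub>A //\<^sub>r F\<^esub> \<longleftrightarrow> \<bottom>\<^sub>r \<notin> F"
    by (simp add: rl_quotient_simps class_eq_one_iff[OF F] bot_closed)
  ultimately show ?thesis
    using quotient_residuated_lattice[OF F] F
    by (simp add: rl_domain_def prime_filter_iff_join proper_filter_iff)
qed

section \<open>The characterisation of mp residuated lattices\<close>

theorem theorem3p7:
  fixes A :: "('a, 'b) residuated_lattice_scheme"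
  assumes "residuated_lattice A"
  shows "(mp_residuated_lattice A \<longleftrightarrow>
            (\<forall>P. prime_filter A P \<longrightarrow> rl_domain (A //\<^sub>r D_set A P)))
       \<and> (mp_residuated_lattice A \<longleftrightarrow>
            (\<forall>M. maximal_filter A M \<longrightarrow> rl_domain (A //\<^sub>r D_set A M)))"
proof -
  interpret residuated_lattice A by (rule assms)
  have dom: "rl_domain (A //\<^sub>r D_set A P) \<longleftrightarrow> prime_filter A (D_set A P)"
    if "prime_filter A P" for P
    using that by (intro quotient_domain_iff_prime D_set_filter)
  show ?thesis
    using dom mp_D_set_prime mp_if_maximal_D_set_prime maximal_filter_prime by metis
qed

end
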